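(* Let $A\in\mathbb{R}^{m\times n}$ have no zero row and no zero column, and let $B\in\mathbb{R}^{m\times p}$. Let $X^{(0)}\in\mathbb{R}^{n\times p}$ satisfy $X^{(0)}_{:,j}\in R(A^T)$ for $j=1,\dots,p$, let $Y^{(0)}\in\mathbb{R}^{n\times p}$ be arbitrary, $R^{(0)}=B-AY^{(0)}$, and for $k\ge0$ let $$W^{(k)}=\frac{(A_{:,j})^TR^{(k)}}{\|A_{:,j}\|_2^2},\qquad Y^{(k+1)}_{j,:}=Y^{(k)}_{j,:}+W^{(k)},\qquad R^{(k+1)}=R^{(k)}-A_{:,j}W^{(k)},$$ (all rows of $Y^{(k)}$ other than the $j$th being left unchanged) and $$X^{(k+1)}=X^{(k)}-(A_{i,:})^T\,\frac{A_{i,:}(X^{(k)}-Y^{(k+1)})}{\|A_{i,:}\|_2^2},$$ where at each iteration the row index $i$ and the column index $j$ of $A$ are selected at random with probabilities $\|A_{i,:}\|_2^2/\|A\|_F^2$ and $\|A_{:,j}\|_2^2/\|A\|_F^2$, respectively. Then $\{X^{(k)}\}$ converges linearly in mean square to $A^+B$, and for all $k\ge0$ $$E\bigl[\|X^{(k+1)}-A^+B\|_F^2\bigr]\le\frac{(k+1)\rho^{k+1}}{\|A\|_F^2}\|AY^{(0)}-AA^+B\|_F^2+\rho^{k+1}\|X^{(0)}-A^+B\|_F^2,$$ where $\rho=1-\dfrac{\sigma_{\min}^2(A)}{\|A\|_F^2}$.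
   Context: $A_{i,:}$ and $A_{:,j}$ denote the $i$th row and $j$th column of $A$, $R(A^T)$ the column space of $A^T$ (not to be confused with the residual matrices $R^{(k)}$), $A^+$ the Moore-Penrose inverse, $\|\cdot\|_F$ the Frobenius norm, and $\sigma_{\min}(A)$ the smallest nonzero singular value of $A$. $A$ may be rank deficient and $AX=B$ may be inconsistent. All index selections (row and column, and over different iterations) are independent. "Converges linearly in mean square to $X^*$" means that $E[\|X^{(k)}-X^*\|_F^2]\to 0$ at a geometric rate (bounded by $c\,q^k$ for some $c\ge 0$ and $q\in[0,1)$). *)

theory Defs
  imports "HOL-Probability.Probability"
begin

definition frobenius_norm :: "real^'n^'m \<Rightarrow> real" where
  "frobenius_norm A = sqrt (\<Sum>i\<in>UNIV. \<Sum>j\<in>UNIV. (A $ i $ j)\<^sup>2)"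

lemma frobenius_norm_eq_norm: "frobenius_norm A = norm A"
  by (simp add: frobenius_norm_def norm_vec_def L2_set_def sum_nonneg)

definition outer_product :: "real^'m \<Rightarrow> real^'n \<Rightarrow> real^'n^'m" where
  "outer_product u w = (\<chi> i j. u $ i * w $ j)"

text \<open>The four Penrose conditions.\<close>

definition is_pinv :: "real^'n^'m \<Rightarrow> real^'m^'n \<Rightarrow> bool" where
  "is_pinv A P \<longleftrightarrow> A ** P ** A = A \<and> P ** A ** P = P \<and>
     transpose (A ** P) = A ** P \<and> transpose (P ** A) = P ** A"

definition pinv :: "real^'n^'m \<Rightarrow> real^'m^'n" where
  "pinv A = (THE P. is_pinv A P)"

text \<open>Singular values are the square roots of the eigenvalues of the Gram matrix
  \<open>transpose A ** A\<close>; only the nonzero ones are collected here.\<close>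

definition nonzero_singular_values :: "real^'n^'m \<Rightarrow> real set" where
  "nonzero_singular_values A =
     {\<sigma>. \<sigma> > 0 \<and> (\<exists>v. v \<noteq> 0 \<and> (transpose A ** A) *v v = \<sigma>\<^sup>2 *\<^sub>R v)}"

definition sigma_min :: "real^'n^'m \<Rightarrow> real" where
  "sigma_min A = Min (nonzero_singular_values A)"

definition column_space :: "real^'n^'m \<Rightarrow> (real^'m) set" where
  "column_space A = span (columns A)"

text \<open>Integrability is part of the notion, since the Bochner integral of a
  non-integrable function is 0 by convention.\<close>

definition converges_linearly_in_mean_square ::
    "'a measure \<Rightarrow> (nat \<Rightarrow> 'a \<Rightarrow> real^'p^'n) \<Rightarrow> real^'p^'n \<Rightarrow> bool" where
  "converges_linearly_in_mean_square M X L \<longleftrightarrow>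
     (\<forall>k. integrable M (\<lambda>\<omega>. (frobenius_norm (X k \<omega> - L))\<^sup>2)) \<and>
     (\<exists>c q. 0 \<le> c \<and> 0 \<le> q \<and> q < 1 \<and>
        (\<forall>k. (\<integral>\<omega>. (frobenius_norm (X k \<omega> - L))\<^sup>2 \<partial>M) \<le> c * q ^ k))"

text \<open>Mutual independence of all row and column selections. The two families take values
  in different types, so they are injected into the sum type and indexed by
  \<open>nat + nat\<close>.\<close>

definition independent_selections ::
    "'a measure \<Rightarrow> (nat \<Rightarrow> 'a \<Rightarrow> 'm) \<Rightarrow> (nat \<Rightarrow> 'a \<Rightarrow> 'n) \<Rightarrow> bool" where
  "independent_selections M I J \<longleftrightarrow>
     prob_space.indep_vars M (\<lambda>_. count_space (UNIV :: ('m + 'n) set))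
       (case_sum (\<lambda>k \<omega>. Inl (I k \<omega>)) (\<lambda>k \<omega>. Inr (J k \<omega>))) (UNIV :: (nat + nat) set)"

text \<open>Well-definedness of \<^const>\<open>pinv\<close> and \<^const>\<open>sigma_min\<close>.\<close>

lemma inner_matrix_transpose: "(A *v x) \<bullet> y = x \<bullet> (transpose A *v y)" for A :: "real^'n^'m"
  by (metis dot_lmul_matrix inner_commute vector_transpose_matrix transpose_transpose)

lemma is_pinv_unique:
  assumes "is_pinv A P" "is_pinv A Q"
  shows "P = Q"
proof -
  have 1: "A ** P = A ** Q"
  proof -
    have "A ** P = transpose (A ** P)" using assms by (simp add: is_pinv_def)
    also have "\<dots> = transpose ((A ** Q) ** (A ** P))"
      using assms by (simp add: is_pinv_def matrix_mul_assoc)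
    also have "\<dots> = (A ** P) ** (A ** Q)"
      using assms by (simp add: is_pinv_def matrix_transpose_mul[of "A ** Q" "A ** P"])
    also have "\<dots> = A ** Q" using assms by (simp add: is_pinv_def matrix_mul_assoc)
    finally show ?thesis .
  qed
  have 2: "P ** A = Q ** A"
  proof -
    have "P ** A = transpose (P ** A)" using assms by (simp add: is_pinv_def)
    also have "\<dots> = transpose ((P ** A) ** (Q ** A))"
      using assms by (metis is_pinv_def matrix_mul_assoc)
    also have "\<dots> = (Q ** A) ** (P ** A)"
      using assms by (simp add: is_pinv_def matrix_transpose_mul[of "P ** A" "Q ** A"])
    also have "\<dots> = Q ** A" using assms by (metis is_pinv_def matrix_mul_assoc)
    finally show ?thesis .
  qed
  show ?thesis using assms 1 2 by (metis is_pinv_def matrix_mul_assoc)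
qed

lemma is_pinv_exists: "\<exists>P. is_pinv A P" for A :: "real^'n^'m"
proof -
  let ?T = "transpose A"
  let ?S = "range ((*v) ?T)"
  have subS: "subspace ?S" by (intro linear_subspace_image) auto
  have inj: "x = y" if "x \<in> ?S" "y \<in> ?S" "?T *v (A *v x) = ?T *v (A *v y)" for x y
  proof -
    have "x - y \<in> ?S" using subS that by (simp add: subspace_diff)
    then obtain u where u: "x - y = ?T *v u" by auto
    have "(A *v (x - y)) \<bullet> (A *v (x - y)) = 0"
      using that(3) unfolding inner_matrix_transpose
      by (simp add: matrix_vector_mult_diff_distrib del: transpose_matrix_vector)
    then have "A *v (x - y) = 0" by simp
    then have "(x - y) \<bullet> (x - y) = 0"
      by (metis u inner_matrix_transpose inner_zero_left)
    then show ?thesis by simp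
  qed
  have ex: "\<exists>x\<in>?S. ?T *v (A *v x) = ?T *v b" for b
  proof -
    have R: "subspace (range ((*v) A))" by (intro linear_subspace_image) auto
    obtain y w where y: "y \<in> span (range ((*v) A))"
      "\<And>z. z \<in> span (range ((*v) A)) \<Longrightarrow> orthogonal w z" "b = y + w"
      using orthogonal_subspace_decomp_exists[of "range ((*v) A)" b] by metis
    then obtain z where z: "y = A *v z" using R by (auto simp: span_eq_iff[THEN iffD2])
    have "(?T *v w) \<bullet> (?T *v w) = 0"
      using y(2)[of "A *v (?T *v w)"] unfolding inner_matrix_transpose[symmetric]
      by (simp add: span_base orthogonal_def inner_commute)
    then have w: "?T *v w = 0" by simp
    obtain x u where x: "x \<in> span ?S" "\<And>s. s \<in> span ?S \<Longrightarrow> orthogonal u s" "z = x + u"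
      using orthogonal_subspace_decomp_exists[of ?S z] by metis
    have "(A *v u) \<bullet> (A *v u) = 0"
      using x(2)[of "?T *v (A *v u)"]
      by (simp add: span_base orthogonal_def inner_matrix_transpose)
    then have u: "A *v u = 0" by simp
    have "x \<in> ?S" using x(1) subS by (auto simp: span_eq_iff[THEN iffD2])
    moreover have "?T *v (A *v x) = ?T *v b"
      by (simp add: y(3) z x(3) matrix_vector_right_distrib u w del: transpose_matrix_vector)
    ultimately show ?thesis by blast
  qed
  obtain f where f: "\<And>b. f b \<in> ?S" "\<And>b. ?T *v (A *v f b) = ?T *v b"
    using ex by metis
  have lin: "linear f"
  proof (rule linearI)
    show "f (b + c) = f b + f c" for b c
      by (rule inj) (auto simp: f subspace_add[OF subS] matrix_vector_right_distrib simp del: transpose_matrix_vector)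
    show "f (r *\<^sub>R b) = r *\<^sub>R f b" for r b
      by (rule inj) (auto simp: f subspace_scale[OF subS] matrix_vector_mult_scaleR simp del: transpose_matrix_vector)
  qed
  define P where "P = matrix f"
  have P: "P *v b = f b" for b
    unfolding P_def using lin by (simp add: matrix_works)
  have sym: "transpose Q = Q" if "\<And>x y. (Q *v x) \<bullet> y = x \<bullet> (Q *v y)" for Q :: "real^'k^'k"
  proof -
    have "x \<bullet> (transpose Q *v y) = x \<bullet> (Q *v y)" for x y
      using that by (simp add: inner_matrix_transpose)
    then show ?thesis by (metis matrix_eq vector_eq_ldot)
  qed
  have AfA: "A *v f (A *v x) = A *v x" for x
  proof -
    have "?T *v (A *v (f (A *v x) - x)) = 0"
      by (simp add: matrix_vector_mult_diff_distrib f del: transpose_matrix_vector)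
    then have "(A *v (f (A *v x) - x)) \<bullet> (A *v (f (A *v x) - x)) = 0"
      by (metis inner_matrix_transpose inner_zero_right)
    then show ?thesis by (simp add: matrix_vector_mult_diff_distrib)
  qed
  have "A ** P ** A = A"
    by (simp add: matrix_eq matrix_vector_mul_assoc[symmetric] P AfA)
  moreover have "P ** A ** P = P"
  proof -
    have "f (A *v f x) = f x" for x
      by (rule inj) (simp_all only: f)
    then show ?thesis by (simp add: matrix_eq matrix_vector_mul_assoc[symmetric] P)
  qed
  moreover have "transpose (A ** P) = A ** P"
  proof (rule sym)
    have *: "(A *v f x) \<bullet> y = (A *v f x) \<bullet> (A *v f y)" for x y
      by (simp add: inner_matrix_transpose f del: transpose_matrix_vector)
    show "((A ** P) *v x) \<bullet> y = x \<bullet> ((A ** P) *v y)" for x y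
      using *[of x y] *[of y x]
      by (simp add: matrix_vector_mul_assoc[symmetric] P inner_commute)
  qed
  moreover have "transpose (P ** A) = P ** A"
  proof (rule sym)
    have *: "f (A *v x) \<bullet> y = f (A *v x) \<bullet> f (A *v y)" for x y
    proof -
      obtain u where u: "f (A *v x) = ?T *v u" using f(1)[of "A *v x"] by auto
      show ?thesis unfolding u
        by (simp only: inner_matrix_transpose[of "transpose A"] transpose_transpose AfA)
    qed
    show "((P ** A) *v x) \<bullet> y = x \<bullet> ((P ** A) *v y)" for x y
      using *[of x y] *[of y x]
      by (simp add: matrix_vector_mul_assoc[symmetric] P inner_commute)
  qed
  ultimately show ?thesis unfolding is_pinv_def by blast
qed

lemma is_pinv_pinv: "is_pinv A (pinv A)"
  unfolding pinv_def by (rule theI') (metis is_pinv_exists is_pinv_unique)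

lemma finite_nonzero_singular_values: "finite (nonzero_singular_values A)"
  for A :: "real^'n^'m"
proof -
  let ?G = "transpose A ** A"
  have "\<forall>\<sigma>\<in>nonzero_singular_values A. \<exists>v. v \<noteq> 0 \<and> ?G *v v = \<sigma>\<^sup>2 *\<^sub>R v"
    by (auto simp: nonzero_singular_values_def)
  then obtain v where v: "\<And>\<sigma>. \<sigma> \<in> nonzero_singular_values A \<Longrightarrow>
      v \<sigma> \<noteq> 0 \<and> ?G *v v \<sigma> = \<sigma>\<^sup>2 *\<^sub>R v \<sigma>" by metis
  have orth: "v s \<bullet> v t = 0"
    if st: "s \<in> nonzero_singular_values A" "t \<in> nonzero_singular_values A" "s \<noteq> t" for s t
  proof -
    have "s\<^sup>2 * (v s \<bullet> v t) = (?G *v v s) \<bullet> v t" using v st by simp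
    also have "\<dots> = v s \<bullet> (?G *v v t)"
      by (simp add: inner_matrix_transpose matrix_transpose_mul)
    also have "\<dots> = t\<^sup>2 * (v s \<bullet> v t)" using v st by simp
    finally have "(s\<^sup>2 - t\<^sup>2) * (v s \<bullet> v t) = 0" by (simp add: algebra_simps)
    moreover have "s\<^sup>2 \<noteq> t\<^sup>2" using st by (auto simp: nonzero_singular_values_def power2_eq_iff)
    ultimately show ?thesis by simp
  qed
  have "inj_on v (nonzero_singular_values A)"
    by (rule inj_onI) (metis orth v inner_eq_zero_iff)
  moreover have "independent (v ` nonzero_singular_values A)"
    by (rule pairwise_orthogonal_independent)
       (auto simp: pairwise_def orthogonal_def intro: orth dest: v)
  ultimately show ?thesis
    using independent_imp_finite finite_imageD by blast
qed

lemma nonzero_singular_values_nonempty: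
  fixes A :: "real^'n^'m"
  assumes "A \<noteq> 0"
  shows "nonzero_singular_values A \<noteq> {}"
proof -
  let ?S = "sphere (0::real^'n) 1"
  have "?S \<noteq> {}" by (simp add: sphere_eq_empty)
  moreover have "continuous_on ?S (\<lambda>x. norm (A *v x))"
    by (intro continuous_intros linear_continuous_on) (simp add: linear_conv_bounded_linear[symmetric])
  ultimately obtain v where v: "v \<in> ?S" "\<And>x. x \<in> ?S \<Longrightarrow> norm (A *v x) \<le> norm (A *v v)"
    using continuous_attains_sup[of ?S "\<lambda>x. norm (A *v x)"] by (auto simp: compact_sphere)
  define s where "s = norm (A *v v)"
  have nv: "norm v = 1" using v(1) by simp
  have bd: "norm (A *v x) \<le> s * norm x" for x
  proof (cases "x = 0")
    case False
    then have "norm (A *v (inverse (norm x) *\<^sub>R x)) \<le> s"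
      unfolding s_def by (intro v(2)) simp
    with False show ?thesis by (simp add: matrix_vector_mult_scaleR field_simps)
  qed simp
  have s: "s > 0"
  proof (rule ccontr)
    assume "\<not> s > 0"
    then have "s = 0" by (simp add: s_def)
    then have "A *v x = 0 *v x" for x using bd[of x] by simp
    then show False using assms by (metis matrix_eq)
  qed
  let ?w = "transpose A *v (A *v v)"
  have "norm ?w ^ 2 \<le> s * norm ?w * s"
  proof -
    have "norm ?w ^ 2 = (A *v ?w) \<bullet> (A *v v)"
      by (simp add: power2_norm_eq_inner inner_matrix_transpose)
    also have "\<dots> \<le> norm (A *v ?w) * s" unfolding s_def by (rule norm_cauchy_schwarz)
    also have "\<dots> \<le> s * norm ?w * s" using bd[of ?w] s by (intro mult_right_mono) auto
    finally show ?thesis .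
  qed
  then have "norm ?w \<le> s\<^sup>2"
    using s by (cases "norm ?w = 0") (auto simp: power2_eq_square mult.commute mult.left_commute)
  then have wle: "?w \<bullet> ?w \<le> s\<^sup>2 * s\<^sup>2"
    by (metis power2_norm_eq_inner power2_eq_square norm_ge_zero power_mono)
  have wv: "?w \<bullet> v = s\<^sup>2"
    by (simp add: s_def power2_norm_eq_inner inner_matrix_transpose inner_commute)
  have "(?w - s\<^sup>2 *\<^sub>R v) \<bullet> (?w - s\<^sup>2 *\<^sub>R v) = ?w \<bullet> ?w - 2 * (s\<^sup>2 * (?w \<bullet> v)) + s\<^sup>2 * s\<^sup>2 * (v \<bullet> v)"
    by (simp add: inner_diff_left inner_diff_right inner_commute algebra_simps)
  also have "\<dots> \<le> 0" using wle nv unfolding wv by (simp add: norm_eq_1 power2_eq_square)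
  finally have "?w = s\<^sup>2 *\<^sub>R v"
    by (metis inner_eq_zero_iff inner_ge_zero order_antisym right_minus_eq)
  then have "s \<in> nonzero_singular_values A"
    unfolding nonzero_singular_values_def using s nv
    by (auto simp: matrix_vector_mul_assoc[symmetric] intro!: exI[of _ v])
  then show ?thesis by blast
qed

end

(* Write L = A^+ B, D(k) = X(k) - L and E(k) = A (Y(k) - L). Since A^T (B - A L) = 0, the column
   step projects E(k) off a random column of A, while the row step projects D(k) off a random row a
   of A and adds the component along a of Y(k+1) - L. The two summands of D(k+1) are orthogonal, so
   averaging over the new index alone gives
     E|E(k+1)|^2 <= rho E|E(k)|^2,   E|D(k+1)|^2 <= rho E|D(k)|^2 + E|E(k+1)|^2 / |A|^2,
   because |A x| >= sigma_min |x| on the range of A^T and |A^T y| >= sigma_min |y| on the range of A.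
   Every iterate is a function of finitely many index selections, so no conditional expectation is
   needed: the new index is independent of a finite-valued history. *)
theory Submission
  imports Defs
begin

section \<open>Matrix products, Frobenius norms and outer products\<close>

lemma row_matrix_mul: "row i (A ** M) = row i A v* M"
  for A :: "real^'n^'m"
  by (simp add: vec_eq_iff row_def matrix_matrix_mult_def vector_matrix_mult_def)

lemma column_matrix_mul: "column j (A ** M) = A *v column j M"
  for A :: "real^'n^'m"
  by (simp add: vec_eq_iff column_def matrix_matrix_mult_def matrix_vector_mult_def)

lemma norm_sq_eq_sum_rows: "(norm M)\<^sup>2 = (\<Sum>i\<in>UNIV. (norm (row i M))\<^sup>2)"
  for M :: "real^'n^'m"
  by (simp add: norm_vec_def L2_set_def sum_nonneg row_def)

lemma norm_transpose: "norm (transpose M) = norm M"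
  for M :: "real^'n^'m"
proof -
  have "(\<Sum>i\<in>UNIV. \<Sum>j\<in>UNIV. (M $ j $ i)\<^sup>2) = (\<Sum>i\<in>UNIV. \<Sum>j\<in>UNIV. (M $ i $ j)\<^sup>2)"
    by (rule sum.swap)
  then show ?thesis
    by (simp add: frobenius_norm_eq_norm[symmetric] frobenius_norm_def transpose_def)
qed

lemma norm_sq_eq_sum_columns: "(norm M)\<^sup>2 = (\<Sum>j\<in>UNIV. (norm (column j M))\<^sup>2)"
  for M :: "real^'n^'m"
  using norm_sq_eq_sum_rows[of "transpose M"] by (simp add: norm_transpose)

lemma outer_product_matrix_vector_mult: "outer_product (C *v u) w = C ** outer_product u w"
  for C :: "real^'n^'m"
  by (simp add: vec_eq_iff outer_product_def matrix_matrix_mult_def matrix_vector_mult_def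
      sum_distrib_right mult.assoc)

text \<open>Exhibits a rank-one update along a column of \<open>C\<close> as a multiple
  \<open>C ** _\<close>, so that updates commute with multiplication by \<open>A\<close> and
  preserve ranges.\<close>

lemma outer_product_column: "outer_product (column j C) w = C ** outer_product (axis j 1) w"
  for C :: "real^'n^'m"
  by (metis matrix_vector_mult_basis outer_product_matrix_vector_mult)

lemma outer_product_row: "outer_product (row i C) w = transpose C ** outer_product (axis i 1) w"
  for C :: "real^'n^'m"
  by (metis column_transpose outer_product_column)

lemma inner_outer_product: "outer_product u w \<bullet> M = w \<bullet> (u v* M)"
  by (simp add: inner_vec_def outer_product_def vector_matrix_mult_def sum_distrib_left mult_ac,
      rule sum.swap)

lemma vector_matrix_mult_outer_product: "v v* outer_product u w = (v \<bullet> u) *\<^sub>R w"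
  by (simp add: vec_eq_iff outer_product_def vector_matrix_mult_def inner_vec_def
      sum_distrib_left sum_distrib_right mult_ac)

section \<open>A single projection step and its average over the rows\<close>

text \<open>Pythagoras: the updated matrix is the part of \<open>M\<close> whose columns are
  orthogonal to \<open>a\<close>, plus the component of \<open>G\<close> along \<open>a\<close>.
  With \<open>G = 0\<close> it is a plain orthogonal projection.\<close>

lemma norm_sq_row_update:
  fixes M G :: "real^'p^'n" and a :: "real^'n"
  assumes "a \<noteq> 0"
  shows "(norm (M - outer_product a ((1 / (norm a)\<^sup>2) *\<^sub>R (a v* (M - G)))))\<^sup>2 =
    (norm M)\<^sup>2 - (norm (a v* M))\<^sup>2 / (norm a)\<^sup>2 + (norm (a v* G))\<^sup>2 / (norm a)\<^sup>2"
proof -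
  define c where "c = 1 / (norm a)\<^sup>2"
  define w where "w = a v* M - a v* G"
  have c: "c * (a \<bullet> a) = 1" using assms by (simp add: c_def power2_norm_eq_inner)
  have M: "M \<bullet> outer_product a x = x \<bullet> (a v* M)" for x
    by (metis inner_commute inner_outer_product)
  have "(norm (M - outer_product a (c *\<^sub>R w)))\<^sup>2 =
      (norm M)\<^sup>2 - 2 * (c * (w \<bullet> (a v* M))) + c * (c * (a \<bullet> a)) * (w \<bullet> w)"
    by (simp add: power2_norm_eq_inner inner_diff_left inner_diff_right inner_outer_product
        M vector_matrix_mult_outer_product algebra_simps)
  also have "\<dots> = (norm M)\<^sup>2 - c * (norm (a v* M))\<^sup>2 + c * (norm (a v* G))\<^sup>2"
    unfolding c w_def
    by (simp add: power2_norm_eq_inner inner_diff_left inner_diff_right inner_commute algebra_simps)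
  finally show ?thesis
    unfolding w_def c_def by (simp add: vector_matrix_mult_diff_rdistrib)
qed

text \<open>The weights cancel the denominators \<open>(norm (row i C))\<^sup>2\<close>, so the
  rowwise terms add up to Frobenius norms of \<open>C ** M\<close> and
  \<open>C ** G\<close>.\<close>

lemma sum_norm_sq_row_update:
  fixes C :: "real^'n^'m" and M G :: "real^'p^'n"
  assumes "\<And>i. row i C \<noteq> 0"
  shows "(\<Sum>i\<in>UNIV. (norm (row i C))\<^sup>2 / (norm C)\<^sup>2 *
      (norm (M - outer_product (row i C)
        ((1 / (norm (row i C))\<^sup>2) *\<^sub>R (row i C v* (M - G)))))\<^sup>2) =
    (norm M)\<^sup>2 - (norm (C ** M))\<^sup>2 / (norm C)\<^sup>2 + (norm (C ** G))\<^sup>2 / (norm C)\<^sup>2"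
proof -
  have C: "(norm C)\<^sup>2 \<noteq> 0"
    using assms[of undefined] by (auto simp: row_def)
  have "(norm (row i C))\<^sup>2 / (norm C)\<^sup>2 *
      (norm (M - outer_product (row i C)
        ((1 / (norm (row i C))\<^sup>2) *\<^sub>R (row i C v* (M - G)))))\<^sup>2 =
      ((norm (row i C))\<^sup>2 * (norm M)\<^sup>2 - (norm (row i (C ** M)))\<^sup>2 + (norm (row i (C ** G)))\<^sup>2)
        / (norm C)\<^sup>2" for i
    unfolding norm_sq_row_update[OF assms] row_matrix_mul
    using assms[of i] C by (simp add: field_simps)
  then have "(\<Sum>i\<in>UNIV. (norm (row i C))\<^sup>2 / (norm C)\<^sup>2 *
      (norm (M - outer_product (row i C)
        ((1 / (norm (row i C))\<^sup>2) *\<^sub>R (row i C v* (M - G)))))\<^sup>2) =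
      (\<Sum>i\<in>UNIV. ((norm (row i C))\<^sup>2 * (norm M)\<^sup>2 - (norm (row i (C ** M)))\<^sup>2
        + (norm (row i (C ** G)))\<^sup>2) / (norm C)\<^sup>2)"
    by (intro sum.cong refl)
  also have "\<dots> = ((norm C)\<^sup>2 * (norm M)\<^sup>2 - (norm (C ** M))\<^sup>2 + (norm (C ** G))\<^sup>2) / (norm C)\<^sup>2"
    by (simp only: sum.distrib sum_subtractf sum_divide_distrib[symmetric]
        sum_distrib_right[symmetric] norm_sq_eq_sum_rows[symmetric])
  finally show ?thesis using C by (simp add: field_simps)
qed

section \<open>Lower bounds by the smallest nonzero singular value, and the pseudoinverse\<close>

text \<open>The candidate is the minimum of \<open>norm (A *v x)\<close> over unit vectors in the
  range of A^T, attained by compactness. It is positive because \<open>A\<close> is injective on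
  that range, and a minimiser is an eigenvector of the Gram matrix.\<close>

lemma nonzero_singular_value_minimal:
  fixes A :: "real^'n^'m"
  assumes "A \<noteq> 0"
  obtains s where "s \<in> nonzero_singular_values A"
    "\<And>x. x \<in> range ((*v) (transpose A)) \<Longrightarrow> s * norm x \<le> norm (A *v x)"
proof -
  let ?T = "range ((*v) (transpose A))"
  have subT: "subspace ?T"
    by (intro linear_subspace_image) auto
  let ?K = "sphere 0 1 \<inter> ?T"
  have scale: "inverse (norm x) *\<^sub>R x \<in> ?K" if "x \<in> ?T" "x \<noteq> 0" for x
    using that subspace_scale[OF subT that(1)] by simp
  have "?K \<noteq> {}"
  proof -
    have "transpose A \<noteq> 0" using assms by (metis norm_transpose norm_eq_zero)
    then obtain u where "transpose A *v u \<noteq> 0" by (metis matrix_eq matrix_vector_mult_0)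
    then show ?thesis using scale by blast
  qed
  moreover have "compact ?K"
    by (intro compact_Int_closed closed_subspace subT) simp
  moreover have "continuous_on ?K (\<lambda>x. norm (A *v x))"
    by (intro continuous_intros linear_continuous_on) (simp add: linear_conv_bounded_linear[symmetric])
  ultimately have "\<exists>v\<in>?K. \<forall>x\<in>?K. norm (A *v v) \<le> norm (A *v x)"
    by (intro continuous_attains_inf)
  then obtain v where v: "v \<in> ?K" "\<And>x. x \<in> ?K \<Longrightarrow> norm (A *v v) \<le> norm (A *v x)"
    by blast
  define s where "s = norm (A *v v)"
  have nv: "v \<bullet> v = 1" using v(1) by (simp add: norm_eq_1)
  have bd: "s * norm x \<le> norm (A *v x)" if "x \<in> ?T" for x
  proof (cases "x = 0")
    case False
    then have "s \<le> norm (A *v (inverse (norm x) *\<^sub>R x))"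
      unfolding s_def by (intro v(2) scale that)
    with False show ?thesis by (simp add: matrix_vector_mult_scaleR field_simps)
  qed simp
  have "s \<noteq> 0"
  proof
    assume "s = 0"
    then have "A *v v = 0" by (simp add: s_def)
    moreover obtain u where u: "v = transpose A *v u" using v(1) by blast
    have "v \<bullet> v = (A *v v) \<bullet> u"
      unfolding inner_matrix_transpose using u by simp
    ultimately have "v \<bullet> v = 0" by simp
    then show False using nv by simp
  qed
  then have s: "s > 0" by (simp add: s_def less_le)
  \<comment> \<open>First-order optimality of \<open>v\<close>, tested in the admissible direction \<open>w\<close> itself.\<close>
  define w where "w = (transpose A ** A) *v v - s\<^sup>2 *\<^sub>R v"
  have wT: "w \<in> ?T"
    unfolding w_def matrix_vector_mul_assoc[symmetric]
    by (intro subspace_diff[OF subT] subspace_scale[OF subT] rangeI) (use v(1) in auto)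
  have Avw: "(A *v v) \<bullet> (A *v w) - s\<^sup>2 * (v \<bullet> w) = w \<bullet> w"
  proof -
    have "(A *v v) \<bullet> (A *v w) = ((transpose A ** A) *v v) \<bullet> w"
      by (simp add: matrix_vector_mul_assoc[symmetric] dot_lmul_matrix)
    then show ?thesis by (simp add: w_def inner_diff_left)
  qed
  define d where "d = (norm (A *v w))\<^sup>2 - s\<^sup>2 * (norm w)\<^sup>2"
  \<comment> \<open>Square \<open>bd\<close> at \<open>v + t *\<^sub>R w\<close>; the constant terms
    \<open>s\<^sup>2\<close> on both sides cancel.\<close>
  have quad: "0 \<le> 2 * t * (w \<bullet> w) + t\<^sup>2 * d" for t
  proof -
    have "v + t *\<^sub>R w \<in> ?T"
      using v(1) wT by (intro subspace_add[OF subT] subspace_scale[OF subT]) auto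
    from bd[OF this] have "(s * norm (v + t *\<^sub>R w))\<^sup>2 \<le> (norm (A *v (v + t *\<^sub>R w)))\<^sup>2"
      using s by (intro power_mono) auto
    moreover have "(norm (A *v (v + t *\<^sub>R w)))\<^sup>2 =
        s\<^sup>2 + 2 * t * ((A *v v) \<bullet> (A *v w)) + t\<^sup>2 * (norm (A *v w))\<^sup>2"
      by (simp add: s_def power2_norm_eq_inner matrix_vector_right_distrib matrix_vector_mult_scaleR
          inner_add_left inner_add_right inner_commute power2_eq_square[of t] algebra_simps)
    moreover have "(s * norm (v + t *\<^sub>R w))\<^sup>2 =
        s\<^sup>2 * (1 + 2 * t * (v \<bullet> w) + t\<^sup>2 * (norm w)\<^sup>2)"
      by (simp add: power_mult_distrib power2_norm_eq_inner nv
          inner_add_left inner_add_right inner_commute power2_eq_square[of t] algebra_simps)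
    ultimately have "0 \<le> 2 * t * ((A *v v) \<bullet> (A *v w) - s\<^sup>2 * (v \<bullet> w)) + t\<^sup>2 * d"
      by (simp add: d_def algebra_simps)
    then show ?thesis by (simp add: Avw)
  qed
  have "w \<bullet> w \<le> 0"
  proof (rule ccontr)
    assume w: "\<not> w \<bullet> w \<le> 0"
    \<comment> \<open>A negative \<open>t\<close> so small that the linear term of
      \<open>quad\<close> outweighs the quadratic one; the \<open>+ 1\<close> guards against
      \<open>d = 0\<close>.\<close>
    define t where "t = - (w \<bullet> w) / (\<bar>d\<bar> + 1)"
    have t: "t < 0" using w unfolding t_def by (intro divide_neg_pos) auto
    have "\<bar>t * d\<bar> \<le> w \<bullet> w"
      using w by (simp add: t_def abs_mult field_simps)
    then have "2 * (w \<bullet> w) + t * d > 0" using w by linarith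
    then have "t * (2 * (w \<bullet> w) + t * d) < 0" using t by (simp add: mult_neg_pos)
    then show False using quad[of t] by (simp add: power2_eq_square algebra_simps)
  qed
  then have "w = 0" by (metis inner_eq_zero_iff inner_ge_zero order_antisym)
  then have "s \<in> nonzero_singular_values A"
    using s nv by (auto simp: nonzero_singular_values_def w_def intro!: exI[of _ v])
  with bd show thesis by (rule that[rotated])
qed

lemma sigma_min_pos: "A \<noteq> 0 \<Longrightarrow> sigma_min A > 0"
  using Min_in[OF finite_nonzero_singular_values nonzero_singular_values_nonempty]
  by (auto simp: sigma_min_def nonzero_singular_values_def)

text \<open>Test an eigenvector for \<open>sigma_min A\<close> against the rowwise Cauchy-Schwarz
  bound. This yields \<open>0 \<le> \<rho>\<close> later.\<close>

lemma sigma_min_le_norm: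
  fixes A :: "real^'n^'m"
  assumes "A \<noteq> 0"
  shows "sigma_min A \<le> norm A"
proof -
  let ?s = "sigma_min A"
  have "?s \<in> nonzero_singular_values A"
    unfolding sigma_min_def
    by (intro Min_in finite_nonzero_singular_values nonzero_singular_values_nonempty assms)
  then obtain v where v: "v \<noteq> 0" "(transpose A ** A) *v v = ?s\<^sup>2 *\<^sub>R v"
    by (auto simp: nonzero_singular_values_def)
  have "(norm (A *v v))\<^sup>2 = ((transpose A ** A) *v v) \<bullet> v"
    by (simp add: matrix_vector_mul_assoc[symmetric] dot_lmul_matrix power2_norm_eq_inner)
  also have "\<dots> = (?s * norm v)\<^sup>2" by (simp add: v power_mult_distrib power2_norm_eq_inner)
  finally have "norm (A *v v) = ?s * norm v"
    using sigma_min_pos[OF assms] by (simp add: power2_eq_iff_nonneg)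
  moreover have "norm (A *v v) \<le> norm A * norm v"
  proof -
    have "(norm (A *v v))\<^sup>2 = (\<Sum>i\<in>UNIV. (row i A \<bullet> v)\<^sup>2)"
      by (simp add: norm_vec_def L2_set_def sum_nonneg matrix_mult_dot row_def)
    also have "\<dots> \<le> (\<Sum>i\<in>UNIV. (norm (row i A))\<^sup>2 * (norm v)\<^sup>2)"
      by (intro sum_mono) (metis Cauchy_Schwarz_ineq power2_norm_eq_inner)
    also have "\<dots> = (norm A * norm v)\<^sup>2"
      by (simp add: norm_sq_eq_sum_rows[of A] power_mult_distrib sum_distrib_right)
    finally show ?thesis by (simp add: power2_le_iff_abs_le)
  qed
  ultimately show ?thesis using v(1) by simp
qed

lemma sigma_min_mult_norm_le:
  fixes A :: "real^'n^'m"
  assumes "A \<noteq> 0"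
  shows "sigma_min A * norm (transpose A *v u) \<le> norm (A *v (transpose A *v u))"
proof -
  obtain s where s: "s \<in> nonzero_singular_values A"
    "\<And>x. x \<in> range ((*v) (transpose A)) \<Longrightarrow> s * norm x \<le> norm (A *v x)"
    using nonzero_singular_value_minimal[OF assms] by metis
  have "sigma_min A \<le> s"
    unfolding sigma_min_def using s(1) by (intro Min_le finite_nonzero_singular_values)
  then have "sigma_min A * norm (transpose A *v u) \<le> s * norm (transpose A *v u)"
    by (rule mult_right_mono) simp
  also have "\<dots> \<le> norm (A *v (transpose A *v u))" by (rule s(2)) (rule rangeI)
  finally show ?thesis .
qed

text \<open>P = PAP and the symmetry of PA give P = A^T P^T P. Hence the columns of A^+ B lie in the
  range of A^T.\<close>

lemma pinv_in_row_space: "pinv A = transpose A ** (transpose (pinv A) ** pinv A)"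
proof -
  have "pinv A = transpose (pinv A ** A) ** pinv A"
    using is_pinv_pinv[of A] by (simp add: is_pinv_def)
  then show ?thesis by (simp add: matrix_transpose_mul matrix_mul_assoc)
qed

lemma pinv_mult: "A ** pinv A ** A = A"
  using is_pinv_pinv[of A] by (simp add: is_pinv_def)

text \<open>The normal equation: by symmetry of A A^+, the left side is the transpose of A A^+ A =
  A. Thus A^T annihilates B - A A^+ B even for an inconsistent system.\<close>

lemma transpose_mult_pinv: "transpose A ** (A ** pinv A) = transpose A"
proof -
  have "transpose A ** (A ** pinv A) = transpose A ** transpose (A ** pinv A)"
    using is_pinv_pinv[of A] by (simp add: is_pinv_def)
  then show ?thesis by (metis matrix_transpose_mul pinv_mult)
qed

text \<open>Avoids comparing the singular values of \<open>A\<close> and its transpose. Replace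
  \<open>z\<close> by x = A^+ A z, which has the same image and lies in the range of A^T; then
  |Ax|^2 = x . A^T A x \<le> |x| |A^T A x|, and |x| is bounded by |Ax| /
  \<open>sigma_min A\<close>.\<close>

lemma sigma_min_mult_norm_le_transpose:
  fixes A :: "real^'n^'m"
  assumes "A \<noteq> 0"
  shows "sigma_min A * norm (A *v z) \<le> norm (transpose A *v (A *v z))"
proof (cases "A *v z = 0")
  case False
  define x where "x = pinv A *v (A *v z)"
  have Ax: "A *v x = A *v z"
    unfolding x_def by (simp add: matrix_vector_mul_assoc matrix_mul_assoc pinv_mult)
  have "x = transpose A *v (transpose (pinv A) *v (pinv A *v (A *v z)))"
    unfolding x_def by (metis pinv_in_row_space matrix_vector_mul_assoc)
  then have *: "sigma_min A * norm x \<le> norm (A *v x)"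
    using sigma_min_mult_norm_le[OF assms] by metis
  have "norm (A *v x) * norm (A *v x) = x \<bullet> (transpose A *v (A *v x))"
    by (metis inner_matrix_transpose power2_norm_eq_inner power2_eq_square)
  also have "\<dots> \<le> norm x * norm (transpose A *v (A *v x))" by (rule norm_cauchy_schwarz)
  finally have "sigma_min A * norm (A *v x) * norm (A *v x) \<le>
      (sigma_min A * norm x) * norm (transpose A *v (A *v x))"
    using sigma_min_pos[OF assms] by simp
  also have "\<dots> \<le> norm (A *v x) * norm (transpose A *v (A *v x))"
    by (rule mult_right_mono[OF *]) simp
  finally show ?thesis using False by (simp add: Ax mult.commute del: transpose_matrix_vector)
qed (simp add: sigma_min_pos)

text \<open>The vector bounds are summed over columns. The first part serves the row step, whose
  error lies in the range of A^T, the second the column step, whose error lies in the range of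
  A.\<close>

lemma sigma_min_sq_mult_norm_sq_le:
  fixes A :: "real^'n^'m"
  assumes "A \<noteq> 0"
  shows "(sigma_min A)\<^sup>2 * (norm (transpose A ** Z))\<^sup>2 \<le> (norm (A ** (transpose A ** Z)))\<^sup>2"
    and "(sigma_min A)\<^sup>2 * (norm (A ** Z'))\<^sup>2 \<le> (norm (transpose A ** (A ** Z')))\<^sup>2"
proof -
  have columnwise: "(sigma_min A)\<^sup>2 * (norm (C ** N))\<^sup>2 \<le> (norm (D ** (C ** N)))\<^sup>2"
    if "\<And>u. sigma_min A * norm (C *v u) \<le> norm (D *v (C *v u))"
    for C :: "real^'i^'j" and D :: "real^'j^'i" and N :: "real^'l^'i"
    unfolding norm_sq_eq_sum_columns[of "C ** N"] norm_sq_eq_sum_columns[of "D ** (C ** N)"]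
      column_matrix_mul sum_distrib_left power_mult_distrib[symmetric]
    using that sigma_min_pos[OF assms] by (intro sum_mono power_mono) auto
  show "(sigma_min A)\<^sup>2 * (norm (transpose A ** Z))\<^sup>2 \<le> (norm (A ** (transpose A ** Z)))\<^sup>2"
    by (rule columnwise) (rule sigma_min_mult_norm_le[OF assms])
  show "(sigma_min A)\<^sup>2 * (norm (A ** Z'))\<^sup>2 \<le> (norm (transpose A ** (A ** Z')))\<^sup>2"
    by (rule columnwise) (rule sigma_min_mult_norm_le_transpose[OF assms])
qed

lemma columns_in_column_spaceE:
  fixes C :: "real^'n^'m" and M :: "real^'p^'m"
  assumes "\<And>j. column j M \<in> column_space C"
  obtains Z where "M = C ** Z"
proof -
  have "column_space C \<subseteq> range ((*v) C)"
    unfolding column_space_def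
  proof (rule span_minimal)
    show "columns C \<subseteq> range ((*v) C)" by (auto simp: columns_image_basis)
    show "subspace (range ((*v) C))" by (intro linear_subspace_image) auto
  qed
  then have "\<forall>j. \<exists>z. column j M = C *v z" using assms by blast
  then obtain z where z: "\<And>j. column j M = C *v z j" by metis
  define Z where "Z = (\<chi> i j. z j $ i)"
  have "column j Z = z j" for j by (simp add: Z_def column_def)
  then have "column j M = column j (C ** Z)" for j by (simp add: z column_matrix_mul)
  then have "M = C ** Z" by (simp add: column_def vec_eq_iff)
  then show thesis by (rule that)
qed

section \<open>Expectations over a selection independent of a finite-valued history\<close>

context prob_space
begin

text \<open>Supplies measurability and integrability of the iterates, which are given only by their
  recursions: every function of a discrete variable is measurable, and finitely many values make it
  bounded.\<close>

lemma finite_range_factor: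
  fixes u :: "'a \<Rightarrow> real"
  assumes S: "S \<in> measurable M (count_space UNIV)" and fin: "finite (S ` space M)"
    and det: "\<And>\<omega> \<omega>'. \<omega> \<in> space M \<Longrightarrow> \<omega>' \<in> space M \<Longrightarrow> S \<omega> = S \<omega>' \<Longrightarrow> u \<omega> = u \<omega>'"
  shows "\<exists>h. \<forall>\<omega>\<in>space M. u \<omega> = h (S \<omega>)" and "integrable M u"
proof -
  \<comment> \<open>A representative of each fibre of \<open>S\<close>; by \<open>det\<close> the
    choice does not affect the value.\<close>
  define h where "h s = u (SOME \<omega>. \<omega> \<in> space M \<and> S \<omega> = s)" for s
  have h: "u \<omega> = h (S \<omega>)" if "\<omega> \<in> space M" for \<omega>
  proof -
    have "(SOME \<omega>'. \<omega>' \<in> space M \<and> S \<omega>' = S \<omega>) \<in> space M \<and>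
        S (SOME \<omega>'. \<omega>' \<in> space M \<and> S \<omega>' = S \<omega>) = S \<omega>"
      by (rule someI) (use that in simp)
    then show ?thesis unfolding h_def by (intro det) (use that in auto)
  qed
  have "(\<lambda>\<omega>. h (S \<omega>)) \<in> borel_measurable M"
    by (rule measurable_compose[OF S]) simp
  then have meas: "u \<in> borel_measurable M"
    by (rule measurable_cong[THEN iffD2, rotated]) (rule h)
  have "u ` space M = h ` S ` space M" by (auto simp: h)
  then have "finite (norm ` u ` space M)" using fin by simp
  then have "norm (u \<omega>) \<le> Max (norm ` u ` space M)" if "\<omega> \<in> space M" for \<omega>
    by (rule Max_ge) (use that in auto)
  then show "integrable M u"
    by (intro integrable_const_bound[OF AE_I2 meas])
  show "\<exists>h. \<forall>\<omega>\<in>space M. u \<omega> = h (S \<omega>)" using h by blast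
qed

text \<open>Split according to the value \<open>z\<close> of \<open>f (T \<omega>)\<close>;
  independence factors each summand. Keeping the sum under the expectation allows pointwise
  identities to be applied to it afterwards.\<close>

lemma expectation_independent_selection:
  fixes S T :: "'a \<Rightarrow> 's" and f :: "'s \<Rightarrow> 'z::finite" and u :: "'z \<Rightarrow> 'a \<Rightarrow> real"
  assumes ind: "indep_var (count_space UNIV) S (count_space UNIV) T"
    and fin: "finite (S ` space M)"
    and det: "\<And>z \<omega> \<omega>'. \<omega> \<in> space M \<Longrightarrow> \<omega>' \<in> space M \<Longrightarrow> S \<omega> = S \<omega>' \<Longrightarrow> u z \<omega> = u z \<omega>'"
  shows "expectation (\<lambda>\<omega>. u (f (T \<omega>)) \<omega>) =
    expectation (\<lambda>\<omega>. \<Sum>z\<in>UNIV. prob {\<omega> \<in> space M. f (T \<omega>) = z} * u z \<omega>)"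
proof -
  have S: "S \<in> measurable M (count_space UNIV)" and T: "T \<in> measurable M (count_space UNIV)"
    using ind by (auto dest: indep_var_rv1 indep_var_rv2)
  have int: "integrable M (u z)" for z
    by (rule finite_range_factor(2)[OF S fin det])
  have "\<forall>z. \<exists>h. \<forall>\<omega>\<in>space M. u z \<omega> = h (S \<omega>)"
    by (intro allI finite_range_factor(1)[OF S fin det])
  from choice[OF this] obtain h where h: "\<And>z \<omega>. \<omega> \<in> space M \<Longrightarrow> u z \<omega> = h z (S \<omega>)"
    by blast
  have int_h: "integrable M (\<lambda>\<omega>. h z (S \<omega>))" for z
  proof -
    have "integrable M (u z) = integrable M (\<lambda>\<omega>. h z (S \<omega>))"
      by (rule Bochner_Integration.integrable_cong[OF refl]) (rule h)
    then show ?thesis using int by simp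
  qed
  have meas: "(\<lambda>\<omega>. f (T \<omega>)) -` {z} \<inter> space M \<in> sets M" for z
    using measurable_compose[OF T, of f "count_space UNIV"] by (rule measurable_sets) auto
  have prod: "expectation (\<lambda>\<omega>. h z (S \<omega>) * indicator {z} (f (T \<omega>))) =
      expectation (u z) * prob {\<omega> \<in> space M. f (T \<omega>) = z}"
    and int_prod: "integrable M (\<lambda>\<omega>. h z (S \<omega>) * indicator {z} (f (T \<omega>)))" for z
  proof -
    have "indep_var borel (h z \<circ> S) borel ((\<lambda>t. indicator {z} (f t) :: real) \<circ> T)"
      by (rule indep_var_compose[OF ind]) auto
    then have *: "indep_var borel (\<lambda>\<omega>. h z (S \<omega>)) borel (\<lambda>\<omega>. indicator {z} (f (T \<omega>)) :: real)"
      by (simp add: comp_def)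
    have ind_eq: "(\<lambda>\<omega>. indicator {z} (f (T \<omega>)) :: real) = indicator ((\<lambda>\<omega>. f (T \<omega>)) -` {z})"
      by (auto simp: indicator_def)
    have int_ind: "integrable M (\<lambda>\<omega>. indicator {z} (f (T \<omega>)) :: real)"
      unfolding ind_eq using meas[of z] by (simp add: integrable_indicator_iff emeasure_eq_measure)
    have "expectation (\<lambda>\<omega>. indicator {z} (f (T \<omega>))) = prob {\<omega> \<in> space M. f (T \<omega>) = z}"
      unfolding ind_eq by (simp add: vimage_def Int_def conj_commute)
    moreover have "expectation (\<lambda>\<omega>. h z (S \<omega>)) = expectation (u z)"
      by (rule Bochner_Integration.integral_cong[OF refl]) (simp only: h)
    ultimately show "expectation (\<lambda>\<omega>. h z (S \<omega>) * indicator {z} (f (T \<omega>))) =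
        expectation (u z) * prob {\<omega> \<in> space M. f (T \<omega>) = z}"
      using indep_var_lebesgue_integral[OF * int_h int_ind] by simp
    show "integrable M (\<lambda>\<omega>. h z (S \<omega>) * indicator {z} (f (T \<omega>)))"
      by (rule indep_var_integrable[OF * int_h int_ind])
  qed
  have "expectation (\<lambda>\<omega>. u (f (T \<omega>)) \<omega>) =
      expectation (\<lambda>\<omega>. \<Sum>z\<in>UNIV. h z (S \<omega>) * indicator {z} (f (T \<omega>)))"
  proof (rule Bochner_Integration.integral_cong[OF refl])
    fix \<omega> assume "\<omega> \<in> space M"
    have "(\<Sum>z\<in>UNIV. h z (S \<omega>) * indicator {z} (f (T \<omega>))) =
        (\<Sum>z\<in>UNIV. if z = f (T \<omega>) then h z (S \<omega>) else 0)"
      by (rule sum.cong) (auto simp: indicator_def)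
    then show "u (f (T \<omega>)) \<omega> = (\<Sum>z\<in>UNIV. h z (S \<omega>) * indicator {z} (f (T \<omega>)))"
      using \<open>\<omega> \<in> space M\<close> by (simp add: h)
  qed
  also have "\<dots> = (\<Sum>z\<in>UNIV. prob {\<omega> \<in> space M. f (T \<omega>) = z} * expectation (u z))"
    by (subst Bochner_Integration.integral_sum[OF int_prod]) (simp only: prod mult.commute)
  also have "\<dots> = expectation (\<lambda>\<omega>. \<Sum>z\<in>UNIV. prob {\<omega> \<in> space M. f (T \<omega>) = z} * u z \<omega>)"
    by (simp add: Bochner_Integration.integral_sum int)
  finally show ?thesis .
qed

text \<open>Disjoint blocks of an independent family are independent for the product sigma-algebras.
  For finite blocks with values in a finite type these are discrete, so \<open>id\<close> transfers
  the claim to \<open>count_space\<close>.\<close>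

lemma indep_var_restrict_count_space:
  fixes V :: "'i \<Rightarrow> 'a \<Rightarrow> 'c::finite"
  assumes V: "indep_vars (\<lambda>_. count_space UNIV) V UNIV"
    and K: "finite K" "finite L" "K \<inter> L = {}"
  shows "indep_var (count_space UNIV) (\<lambda>\<omega>. restrict (\<lambda>i. V i \<omega>) K)
    (count_space UNIV) (\<lambda>\<omega>. restrict (\<lambda>i. V i \<omega>) L)"
proof -
  have "indep_var (PiM K (\<lambda>_. count_space UNIV)) (\<lambda>\<omega>. restrict (\<lambda>i. V i \<omega>) K)
      (PiM L (\<lambda>_. count_space UNIV)) (\<lambda>\<omega>. restrict (\<lambda>i. V i \<omega>) L)"
    by (rule indep_var_restrict[OF V]) (use K in auto)
  moreover have "id \<in> measurable (PiM N (\<lambda>_. count_space (UNIV :: 'c set))) (count_space UNIV)"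
    if "finite N" for N :: "'i set"
    using that by (simp add: count_space_PiM_finite)
  ultimately have "indep_var (count_space UNIV) (id \<circ> (\<lambda>\<omega>. restrict (\<lambda>i. V i \<omega>) K))
      (count_space UNIV) (id \<circ> (\<lambda>\<omega>. restrict (\<lambda>i. V i \<omega>) L))"
    using K by (intro indep_var_compose) auto
  then show ?thesis by simp
qed

lemma finite_restrict_image:
  fixes V :: "'i \<Rightarrow> 'a \<Rightarrow> 'c::finite"
  assumes "finite K"
  shows "finite ((\<lambda>\<omega>. restrict (\<lambda>i. V i \<omega>) K) ` B)"
proof (rule finite_subset)
  show "(\<lambda>\<omega>. restrict (\<lambda>i. V i \<omega>) K) ` B \<subseteq> PiE K (\<lambda>_. UNIV)" by auto
qed (simp add: finite_PiE assms)

end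

lemma matrix_diff_ldistrib: "A ** (B - C) = A ** B - A ** C"
  for A :: "real^'n^'m"
  by (metis add_diff_cancel diff_add_cancel matrix_add_ldistrib)

section \<open>One random step in expectation\<close>

text \<open>\<open>S\<close> is the history fixing \<open>D\<close> and \<open>G\<close>, and
  \<open>T\<close> carries the new index. Both steps are instances: the column step with
  \<open>C = transpose A\<close> and \<open>G = 0\<close>, the row step with \<open>C = A\<close>
  and \<open>G\<close> the error of the new \<open>Y\<close>.\<close>

lemma (in prob_space) expectation_random_row_update:
  fixes S T :: "'a \<Rightarrow> 's" and f :: "'s \<Rightarrow> 'm::finite"
    and C :: "real^'n^'m" and D G :: "'a \<Rightarrow> real^'p^'n"
  assumes rows: "\<And>i. row i C \<noteq> 0"
    and ind: "indep_var (count_space UNIV) S (count_space UNIV) T"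
    and fin: "finite (S ` space M)"
    and prob_row: "\<And>i. prob {\<omega> \<in> space M. f (T \<omega>) = i} = (norm (row i C))\<^sup>2 / (norm C)\<^sup>2"
    and D: "\<And>\<omega> \<omega>'. \<omega> \<in> space M \<Longrightarrow> \<omega>' \<in> space M \<Longrightarrow> S \<omega> = S \<omega>' \<Longrightarrow> D \<omega> = D \<omega>'"
    and G: "\<And>\<omega> \<omega>'. \<omega> \<in> space M \<Longrightarrow> \<omega>' \<in> space M \<Longrightarrow> S \<omega> = S \<omega>' \<Longrightarrow> G \<omega> = G \<omega>'"
    and contraction: "\<And>\<omega>. \<omega> \<in> space M \<Longrightarrow> \<kappa> * (norm (D \<omega>))\<^sup>2 \<le> (norm (C ** D \<omega>))\<^sup>2"
  shows "expectation (\<lambda>\<omega>. (norm (D \<omega> - outer_product (row (f (T \<omega>)) C)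
      ((1 / (norm (row (f (T \<omega>)) C))\<^sup>2) *\<^sub>R (row (f (T \<omega>)) C v* (D \<omega> - G \<omega>)))))\<^sup>2)
    \<le> (1 - \<kappa> / (norm C)\<^sup>2) * expectation (\<lambda>\<omega>. (norm (D \<omega>))\<^sup>2)
      + expectation (\<lambda>\<omega>. (norm (C ** G \<omega>))\<^sup>2) / (norm C)\<^sup>2"
proof -
  define u where "u i \<omega> = (norm (D \<omega> - outer_product (row i C)
      ((1 / (norm (row i C))\<^sup>2) *\<^sub>R (row i C v* (D \<omega> - G \<omega>)))))\<^sup>2" for i \<omega>
  have u: "u i \<omega> = u i \<omega>'" if "\<omega> \<in> space M" "\<omega>' \<in> space M" "S \<omega> = S \<omega>'" for i \<omega> \<omega>'
    unfolding u_def D[OF that] G[OF that] ..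
  have C: "(norm C)\<^sup>2 > 0"
    using rows[of undefined] by (auto simp: row_def)
  have S: "S \<in> measurable M (count_space UNIV)"
    using ind by (rule indep_var_rv1)
  have int_D: "integrable M (\<lambda>\<omega>. (norm (D \<omega>))\<^sup>2)"
    by (rule finite_range_factor(2)[OF S fin]) (use D in metis)
  have int_CD: "integrable M (\<lambda>\<omega>. (norm (C ** D \<omega>))\<^sup>2)"
    by (rule finite_range_factor(2)[OF S fin]) (use D in metis)
  have int_G: "integrable M (\<lambda>\<omega>. (norm (C ** G \<omega>))\<^sup>2)"
    by (rule finite_range_factor(2)[OF S fin]) (use G in metis)
  have "expectation (\<lambda>\<omega>. u (f (T \<omega>)) \<omega>) =
      expectation (\<lambda>\<omega>. \<Sum>i\<in>UNIV. prob {\<omega> \<in> space M. f (T \<omega>) = i} * u i \<omega>)"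
    by (rule expectation_independent_selection[OF ind fin u])
  also have "\<dots> = expectation (\<lambda>\<omega>. (norm (D \<omega>))\<^sup>2 - (norm (C ** D \<omega>))\<^sup>2 / (norm C)\<^sup>2
      + (norm (C ** G \<omega>))\<^sup>2 / (norm C)\<^sup>2)"
    unfolding prob_row u_def sum_norm_sq_row_update[OF rows] ..
  also have "\<dots> \<le> expectation (\<lambda>\<omega>. (1 - \<kappa> / (norm C)\<^sup>2) * (norm (D \<omega>))\<^sup>2
      + (norm (C ** G \<omega>))\<^sup>2 / (norm C)\<^sup>2)"
  proof (rule integral_mono)
    fix \<omega> assume "\<omega> \<in> space M"
    then have "\<kappa> * (norm (D \<omega>))\<^sup>2 / (norm C)\<^sup>2 \<le> (norm (C ** D \<omega>))\<^sup>2 / (norm C)\<^sup>2"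
      using C by (intro divide_right_mono contraction) auto
    then show "(norm (D \<omega>))\<^sup>2 - (norm (C ** D \<omega>))\<^sup>2 / (norm C)\<^sup>2 + (norm (C ** G \<omega>))\<^sup>2 / (norm C)\<^sup>2
        \<le> (1 - \<kappa> / (norm C)\<^sup>2) * (norm (D \<omega>))\<^sup>2 + (norm (C ** G \<omega>))\<^sup>2 / (norm C)\<^sup>2"
      by (simp add: left_diff_distrib)
  qed (use int_D int_CD int_G in auto)
  also have "\<dots> = (1 - \<kappa> / (norm C)\<^sup>2) * expectation (\<lambda>\<omega>. (norm (D \<omega>))\<^sup>2)
      + expectation (\<lambda>\<omega>. (norm (C ** G \<omega>))\<^sup>2) / (norm C)\<^sup>2"
    using int_D int_G by simp
  finally show ?thesis unfolding u_def .
qed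

section \<open>Scalar recursions\<close>

lemma forced_contraction_bound:
  fixes e r :: "nat \<Rightarrow> real"
  assumes \<rho>: "0 \<le> \<rho>" and N: "0 < N"
    and r: "\<And>k. r (Suc k) \<le> \<rho> * r k"
    and e: "\<And>k. e (Suc k) \<le> \<rho> * e k + r (Suc k) / N"
  shows "e k \<le> real k * \<rho> ^ k / N * r 0 + \<rho> ^ k * e 0"
proof (induction k)
  case (Suc k)
  have rk: "r k \<le> \<rho> ^ k * r 0" for k
  proof (induction k)
    case (Suc k)
    show ?case using r[of k] mult_left_mono[OF Suc \<rho>] by simp
  qed simp
  have "e (Suc k) \<le> \<rho> * e k + r (Suc k) / N" by (rule e)
  \<comment> \<open>The forcing term is \<open>r (Suc k)\<close>, already contracted
    \<open>Suc k\<close> times. It carries the same power of \<open>\<rho>\<close> as the propagated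
    terms, so each step raises the linear factor by one.\<close>
  also have "\<dots> \<le> \<rho> * (real k * \<rho> ^ k / N * r 0 + \<rho> ^ k * e 0) + \<rho> ^ Suc k * r 0 / N"
    using N by (intro add_mono mult_left_mono Suc.IH \<rho> divide_right_mono rk) auto
  also have "\<dots> = real (Suc k) * \<rho> ^ Suc k / N * r 0 + \<rho> ^ Suc k * e 0"
    using N by (simp add: field_simps)
  finally show ?case .
qed simp

text \<open>Half of the decay pays for the linear factor: with \<open>q = sqrt \<rho>\<close>,
  \<open>real k * \<rho> ^ k\<close> is \<open>real k * q ^ k\<close>, a bounded sequence, times
  \<open>q ^ k\<close>.\<close>

lemma linear_times_geometric_bound:
  fixes \<rho> :: real
  assumes "0 \<le> \<rho>" "\<rho> < 1"
  obtains c q where "0 \<le> c" "0 \<le> q" "q < 1" "\<And>k. \<rho> ^ k \<le> q ^ k" "\<And>k. real k * \<rho> ^ k \<le> c * q ^ k"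
proof -
  define q where "q = sqrt \<rho>"
  have q: "0 \<le> q" "q < 1" "\<rho> = q * q" using assms by (auto simp: q_def)
  have "Bseq (\<lambda>k. real k * q ^ k)"
    using powser_times_n_limit_0[of q] q by (intro convergent_imp_Bseq convergentI) auto
  then obtain c where c: "c > 0" "\<And>k. norm (real k * q ^ k) \<le> c" by (auto elim: BseqE)
  show thesis
  proof (rule that[of c q])
    show "\<rho> ^ k \<le> q ^ k" for k
      using q by (intro power_mono) (auto intro: mult_left_le_one_le)
    show "real k * \<rho> ^ k \<le> c * q ^ k" for k
    proof -
      have "real k * \<rho> ^ k = (real k * q ^ k) * q ^ k" by (simp add: q(3) power_mult_distrib)
      also have "\<dots> \<le> c * q ^ k" using c(2)[of k] q(1) by (intro mult_right_mono) auto
      finally show ?thesis .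
    qed
  qed (use c q in auto)
qed

theorem theorem4p5:
  fixes A :: "real^'n^'m" and B :: "real^'p^'m"
    and X0 Y0 :: "real^'p^'n"
    and M :: "'a measure"
    and I :: "nat \<Rightarrow> 'a \<Rightarrow> 'm" and J :: "nat \<Rightarrow> 'a \<Rightarrow> 'n"
    and X Y :: "nat \<Rightarrow> 'a \<Rightarrow> real^'p^'n"
    and R :: "nat \<Rightarrow> 'a \<Rightarrow> real^'p^'m"
    and W :: "nat \<Rightarrow> 'a \<Rightarrow> real^'p"
    and \<rho> :: real
  assumes rows: "\<And>i. row i A \<noteq> 0"
    and cols: "\<And>j. column j A \<noteq> 0"
    and X0: "\<And>j. column j X0 \<in> column_space (transpose A)"
    and M: "prob_space M"
    and indep: "independent_selections M I J"
    and row_prob: "\<And>k i. measure M {\<omega> \<in> space M. I k \<omega> = i}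
                     = (norm (row i A))\<^sup>2 / (frobenius_norm A)\<^sup>2"
    and col_prob: "\<And>k j. measure M {\<omega> \<in> space M. J k \<omega> = j}
                     = (norm (column j A))\<^sup>2 / (frobenius_norm A)\<^sup>2"
    and X_0: "\<And>\<omega>. \<omega> \<in> space M \<Longrightarrow> X 0 \<omega> = X0"
    and Y_0: "\<And>\<omega>. \<omega> \<in> space M \<Longrightarrow> Y 0 \<omega> = Y0"
    and R_0: "\<And>\<omega>. \<omega> \<in> space M \<Longrightarrow> R 0 \<omega> = B - A ** Y0"
    and W: "\<And>k \<omega>. \<omega> \<in> space M \<Longrightarrow>
              W k \<omega> = (1 / (norm (column (J k \<omega>) A))\<^sup>2) *\<^sub>R (column (J k \<omega>) A v* R k \<omega>)"
    and Y_Suc: "\<And>k \<omega>. \<omega> \<in> space M \<Longrightarrow>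
              row (J k \<omega>) (Y (Suc k) \<omega>) = row (J k \<omega>) (Y k \<omega>) + W k \<omega>"
    and Y_Suc_other: "\<And>k \<omega> l. \<omega> \<in> space M \<Longrightarrow> l \<noteq> J k \<omega> \<Longrightarrow>
              row l (Y (Suc k) \<omega>) = row l (Y k \<omega>)"
    and R_Suc: "\<And>k \<omega>. \<omega> \<in> space M \<Longrightarrow>
              R (Suc k) \<omega> = R k \<omega> - outer_product (column (J k \<omega>) A) (W k \<omega>)"
    and X_Suc: "\<And>k \<omega>. \<omega> \<in> space M \<Longrightarrow>
              X (Suc k) \<omega> = X k \<omega> - outer_product (row (I k \<omega>) A)
                ((1 / (norm (row (I k \<omega>) A))\<^sup>2) *\<^sub>R
                   (row (I k \<omega>) A v* (X k \<omega> - Y (Suc k) \<omega>)))"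
    and rho: "\<rho> = 1 - (sigma_min A)\<^sup>2 / (frobenius_norm A)\<^sup>2"
  shows "converges_linearly_in_mean_square M X (pinv A ** B) \<and>
    (\<forall>k. (\<integral>\<omega>. (frobenius_norm (X (Suc k) \<omega> - pinv A ** B))\<^sup>2 \<partial>M)
       \<le> real (k + 1) * \<rho> ^ (k + 1) / (frobenius_norm A)\<^sup>2
             * (frobenius_norm (A ** Y0 - A ** pinv A ** B))\<^sup>2
         + \<rho> ^ (k + 1) * (frobenius_norm (X0 - pinv A ** B))\<^sup>2)"
proof -
  interpret prob_space M by (rule M)
  let ?L = "pinv A ** B"
  define D where "D k \<omega> = X k \<omega> - ?L" for k \<omega>
  define E where "E k \<omega> = A ** (Y k \<omega> - ?L)" for k \<omega>
  have A: "A \<noteq> 0" using rows[of undefined] by (auto simp: row_def vec_eq_iff)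
  have nA: "(norm A)\<^sup>2 > 0" using A by simp

  \<comment> \<open>Error recursions of the iterates\<close>
  have Y_update: "Y (Suc k) \<omega> = Y k \<omega> + outer_product (axis (J k \<omega>) 1) (W k \<omega>)"
    if "\<omega> \<in> space M" for k \<omega>
  proof -
    have "row l (Y (Suc k) \<omega>) = row l (Y k \<omega> + outer_product (axis (J k \<omega>) 1) (W k \<omega>))" for l
      using Y_Suc[OF that, of k] Y_Suc_other[OF that, of l k]
      by (cases "l = J k \<omega>") (auto simp: row_def vec_eq_iff outer_product_def axis_def)
    then show ?thesis by (simp add: row_def vec_eq_iff)
  qed
  \<comment> \<open>Makes \<open>R\<close> a function of \<open>Y\<close>, needed for the normal
    equation and for the dependence of \<open>W\<close> on the history.\<close>
  have residual: "R k \<omega> = B - A ** Y k \<omega>" if "\<omega> \<in> space M" for k \<omega>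
  proof (induction k)
    case 0
    show ?case using that by (simp add: R_0 Y_0)
  next
    case (Suc k)
    show ?case
      by (simp add: R_Suc[OF that] Y_update[OF that] Suc matrix_add_ldistrib outer_product_column)
  qed
  \<comment> \<open>The component of \<open>B\<close> outside the range of \<open>A\<close> is
    invisible to the columns of \<open>A\<close>, so \<open>R\<close> acts like \<open>- E\<close>
    in the column step.\<close>
  have normal_eq: "column j A v* R k \<omega> = - (column j A v* E k \<omega>)" if "\<omega> \<in> space M" for j k \<omega>
  proof -
    have "transpose A ** (A ** ?L) = transpose A ** B"
      by (metis matrix_mul_assoc transpose_mult_pinv)
    then have "transpose A ** R k \<omega> = - (transpose A ** E k \<omega>)"
      by (simp add: residual[OF that] E_def matrix_diff_ldistrib)
    then have "row j (transpose A ** R k \<omega>) = - row j (transpose A ** E k \<omega>)"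
      by (simp add: row_def vec_eq_iff)
    then show ?thesis by (simp add: row_matrix_mul)
  qed
  \<comment> \<open>Written as a row step for \<open>transpose A\<close>; the trailing
    \<open>- 0\<close> is the instance \<open>G = 0\<close> of the averaged step.\<close>
  have E_Suc: "E (Suc k) \<omega> = E k \<omega> - outer_product (row (J k \<omega>) (transpose A))
      ((1 / (norm (row (J k \<omega>) (transpose A)))\<^sup>2) *\<^sub>R
        (row (J k \<omega>) (transpose A) v* (E k \<omega> - 0)))" if "\<omega> \<in> space M" for k \<omega>
  proof -
    let ?a = "column (J k \<omega>) A"
    have "E (Suc k) \<omega> = E k \<omega> + outer_product ?a (W k \<omega>)"
      by (simp add: E_def Y_update[OF that] matrix_diff_ldistrib matrix_add_ldistrib outer_product_column)
    also have "\<dots> = E k \<omega> - outer_product ?a ((1 / (norm ?a)\<^sup>2) *\<^sub>R (?a v* E k \<omega>))"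
      by (simp add: W[OF that] normal_eq[OF that] outer_product_def vec_eq_iff)
    finally show ?thesis by simp
  qed
  have D_Suc: "D (Suc k) \<omega> = D k \<omega> - outer_product (row (I k \<omega>) A)
      ((1 / (norm (row (I k \<omega>) A))\<^sup>2) *\<^sub>R (row (I k \<omega>) A v* (D k \<omega> - (Y (Suc k) \<omega> - ?L))))"
    if "\<omega> \<in> space M" for k \<omega>
    by (simp add: D_def X_Suc[OF that])
  \<comment> \<open>Here the assumption on \<open>X0\<close> enters: the singular value bound for
    \<open>A\<close> is available on the range of A^T, which every row update preserves.\<close>
  have D_range: "\<exists>Z. D k \<omega> = transpose A ** Z" if "\<omega> \<in> space M" for k \<omega>
  proof (induction k)
    case 0
    obtain Z where "X0 = transpose A ** Z" using columns_in_column_spaceE[OF X0] by metis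
    moreover have "?L = transpose A ** (transpose (pinv A) ** pinv A ** B)"
      by (metis matrix_mul_assoc pinv_in_row_space)
    ultimately have "D 0 \<omega> = transpose A ** (Z - transpose (pinv A) ** pinv A ** B)"
      using that by (simp add: D_def X_0 matrix_diff_ldistrib)
    then show ?case by blast
  next
    case (Suc k)
    then obtain Z where "D k \<omega> = transpose A ** Z" by blast
    then show ?case
      unfolding D_Suc[OF that] outer_product_row by (metis matrix_diff_ldistrib)
  qed

  \<comment> \<open>Dependence of the iterates on finitely many selections\<close>
  define V where "V = case_sum (\<lambda>k \<omega>. Inl (I k \<omega>) :: 'm + 'n) (\<lambda>k \<omega>. Inr (J k \<omega>))"
  have V: "indep_vars (\<lambda>_. count_space UNIV) V UNIV"
    using indep by (simp add: independent_selections_def V_def)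
  define S where "S K \<omega> = restrict (\<lambda>i. V i \<omega>) K" for K \<omega>
  \<comment> \<open>All row and column selections made before iteration \<open>k\<close>; they
    determine \<open>D k\<close> and \<open>E k\<close>.\<close>
  define past where "past k = Inl ` {..<k} \<union> Inr ` {..<k}" for k :: nat
  have fin_past: "finite (past k)" for k by (simp add: past_def)
  have S_V: "V i \<omega> = V i \<omega>'" if "S K \<omega> = S K \<omega>'" "i \<in> K" for K i \<omega> \<omega>'
    using fun_cong[OF that(1), of i] that(2) by (simp add: S_def)
  have V_I: "V (Inl k) \<omega> = Inl (I k \<omega>)" and V_J: "V (Inr k) \<omega> = Inr (J k \<omega>)" for k \<omega>
    by (simp_all add: V_def)
  have S_past: "I l \<omega> = I l \<omega>' \<and> J l \<omega> = J l \<omega>'"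
    if "S K \<omega> = S K \<omega>'" "past k \<subseteq> K" "l < k" for K k l \<omega> \<omega>'
  proof -
    have "Inl l \<in> K" "Inr l \<in> K" using that(2,3) by (auto simp: past_def)
    then show ?thesis
      using S_V[OF that(1), of "Inl l"] S_V[OF that(1), of "Inr l"] by (simp add: V_I V_J)
  qed
  have Y_det: "Y k \<omega> = Y k \<omega>'" if "\<omega> \<in> space M" "\<omega>' \<in> space M" "\<forall>l<k. J l \<omega> = J l \<omega>'" for k \<omega> \<omega>'
    using that(3)
  proof (induction k)
    case 0
    show ?case using that(1,2) by (simp add: Y_0)
  next
    case (Suc k)
    then have "Y k \<omega> = Y k \<omega>'" "J k \<omega> = J k \<omega>'" by auto
    moreover from this have "W k \<omega> = W k \<omega>'"
      using that(1,2) by (simp add: W residual)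
    ultimately show ?case using that(1,2) by (simp add: Y_update)
  qed
  have D_det: "D k \<omega> = D k \<omega>'"
    if "\<omega> \<in> space M" "\<omega>' \<in> space M" "\<forall>l<k. I l \<omega> = I l \<omega>' \<and> J l \<omega> = J l \<omega>'" for k \<omega> \<omega>'
    using that(3)
  proof (induction k)
    case 0
    show ?case using that(1,2) by (simp add: D_def X_0)
  next
    case (Suc k)
    then have "D k \<omega> = D k \<omega>'" "I k \<omega> = I k \<omega>'" by auto
    moreover have "Y (Suc k) \<omega> = Y (Suc k) \<omega>'"
      using Suc.prems by (intro Y_det that(1,2)) blast
    ultimately show ?case using that(1,2) by (simp add: D_Suc)
  qed
  have D_S: "D k \<omega> = D k \<omega>'"
    if "\<omega> \<in> space M" "\<omega>' \<in> space M" "S K \<omega> = S K \<omega>'" "past k \<subseteq> K" for K k \<omega> \<omega>'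
    by (rule D_det[OF that(1,2)]) (use S_past[OF that(3,4)] in blast)
  have E_S: "E k \<omega> = E k \<omega>'"
    if "\<omega> \<in> space M" "\<omega>' \<in> space M" "S (past k) \<omega> = S (past k) \<omega>'" for k \<omega> \<omega>'
    unfolding E_def by (subst Y_det[OF that(1,2)]) (use S_past[OF that(3) order_refl] in auto)
  \<comment> \<open>\<open>Y (Suc k)\<close> also uses the column index of iteration
    \<open>k\<close>, so \<open>Inr k\<close> joins the history.\<close>
  have Y_S: "Y (Suc k) \<omega> = Y (Suc k) \<omega>'" if "\<omega> \<in> space M" "\<omega>' \<in> space M"
      "S (insert (Inr k) (past k)) \<omega> = S (insert (Inr k) (past k)) \<omega>'" for k \<omega> \<omega>'
  proof (rule Y_det[OF that(1,2)], intro allI impI)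
    fix l assume "l < Suc k"
    then have "Inr l \<in> insert (Inr k) (past k)" by (auto simp: past_def less_Suc_eq)
    from S_V[OF that(3) this] show "J l \<omega> = J l \<omega>'" by (simp add: V_J)
  qed

  have indep_S: "indep_var (count_space UNIV) (S K) (count_space UNIV) (S {b})"
    if "finite K" "b \<notin> K" for K b
    unfolding S_def by (rule indep_var_restrict_count_space[OF V]) (use that in auto)
  have fin_S: "finite (S K ` space M)" if "finite K" for K
    unfolding S_def by (rule finite_restrict_image[OF that])
  have S_J: "projr (S {Inr k} \<omega> (Inr k)) = J k \<omega>"
    and S_I: "projl (S {Inl k} \<omega> (Inl k)) = I k \<omega>" for k \<omega>
    by (simp_all add: S_def V_I V_J)

  \<comment> \<open>The two recursions in expectation\<close>
  have int_D: "integrable M (\<lambda>\<omega>. (norm (D k \<omega>))\<^sup>2)" for k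
    \<comment> \<open>\<open>Inl k\<close> is merely some index outside \<open>past k\<close>:
      independence from it is used only to extract the measurability of
      \<open>S (past k)\<close>.\<close>
    by (rule finite_range_factor(2)[OF indep_var_rv1[OF indep_S[of "past k" "Inl k"]]
          fin_S[OF fin_past]])
       (auto simp: past_def dest: D_S[OF _ _ _ order_refl, unfolded past_def])
  define r where "r k = expectation (\<lambda>\<omega>. (norm (E k \<omega>))\<^sup>2)" for k
  define e where "e k = expectation (\<lambda>\<omega>. (norm (D k \<omega>))\<^sup>2)" for k
  have \<rho>: "\<rho> = 1 - (sigma_min A)\<^sup>2 / (norm A)\<^sup>2"
    by (simp add: rho frobenius_norm_eq_norm)
  have r_Suc: "r (Suc k) \<le> \<rho> * r k" for k
  proof -
    let ?C = "transpose A"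
    let ?j = "\<lambda>\<omega>. projr (S {Inr k} \<omega> (Inr k))"
    have "r (Suc k) = expectation (\<lambda>\<omega>. (norm (E k \<omega> - outer_product (row (?j \<omega>) ?C)
        ((1 / (norm (row (?j \<omega>) ?C))\<^sup>2) *\<^sub>R (row (?j \<omega>) ?C v* (E k \<omega> - 0)))))\<^sup>2)"
      unfolding r_def S_J by (rule Bochner_Integration.integral_cong[OF refl]) (simp only: E_Suc)
    also have "\<dots> \<le> (1 - (sigma_min A)\<^sup>2 / (norm ?C)\<^sup>2) * expectation (\<lambda>\<omega>. (norm (E k \<omega>))\<^sup>2)
        + expectation (\<lambda>\<omega>. (norm (?C ** (0 :: real^'p^'m)))\<^sup>2) / (norm ?C)\<^sup>2"
    proof (rule expectation_random_row_update[where S = "S (past k)" and T = "S {Inr k}"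
          and f = "\<lambda>g. projr (g (Inr k))" and D = "E k" and G = "\<lambda>_. 0"])
      show "indep_var (count_space UNIV) (S (past k)) (count_space UNIV) (S {Inr k})"
        by (rule indep_S[OF fin_past]) (auto simp: past_def)
      show "finite (S (past k) ` space M)" by (rule fin_S[OF fin_past])
      show "row j ?C \<noteq> 0" for j using cols by simp
      show "prob {\<omega> \<in> space M. ?j \<omega> = j} = (norm (row j ?C))\<^sup>2 / (norm ?C)\<^sup>2" for j
        unfolding S_J by (simp add: col_prob frobenius_norm_eq_norm norm_transpose)
      show "(sigma_min A)\<^sup>2 * (norm (E k \<omega>))\<^sup>2 \<le> (norm (?C ** E k \<omega>))\<^sup>2" for \<omega>
        unfolding E_def by (rule sigma_min_sq_mult_norm_sq_le(2)[OF A])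
    qed (rule E_S, assumption+, rule refl)
    finally show ?thesis by (simp add: r_def \<rho> norm_transpose)
  qed
  have e_Suc: "e (Suc k) \<le> \<rho> * e k + r (Suc k) / (norm A)\<^sup>2" for k
  proof -
    \<comment> \<open>The row index is averaged with the column index of the same iteration already
      in the history: \<open>?K\<close> contains \<open>Inr k\<close> but not
      \<open>Inl k\<close>.\<close>
    let ?K = "insert (Inr k) (past k)"
    let ?i = "\<lambda>\<omega>. projl (S {Inl k} \<omega> (Inl k))"
    have "e (Suc k) = expectation (\<lambda>\<omega>. (norm (D k \<omega> - outer_product (row (?i \<omega>) A)
        ((1 / (norm (row (?i \<omega>) A))\<^sup>2) *\<^sub>R
          (row (?i \<omega>) A v* (D k \<omega> - (Y (Suc k) \<omega> - ?L))))))\<^sup>2)"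
      unfolding e_def S_I by (rule Bochner_Integration.integral_cong[OF refl]) (simp only: D_Suc)
    also have "\<dots> \<le> (1 - (sigma_min A)\<^sup>2 / (norm A)\<^sup>2) * expectation (\<lambda>\<omega>. (norm (D k \<omega>))\<^sup>2)
        + expectation (\<lambda>\<omega>. (norm (A ** (Y (Suc k) \<omega> - ?L)))\<^sup>2) / (norm A)\<^sup>2"
    proof (rule expectation_random_row_update[where S = "S ?K" and T = "S {Inl k}"
          and f = "\<lambda>g. projl (g (Inl k))" and D = "D k" and G = "\<lambda>\<omega>. Y (Suc k) \<omega> - ?L"])
      show "indep_var (count_space UNIV) (S ?K) (count_space UNIV) (S {Inl k})"
        by (rule indep_S) (auto simp: past_def)
      show "finite (S ?K ` space M)" by (rule fin_S) (simp add: fin_past)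
      show "row i A \<noteq> 0" for i by (rule rows)
      show "prob {\<omega> \<in> space M. ?i \<omega> = i} = (norm (row i A))\<^sup>2 / (norm A)\<^sup>2" for i
        unfolding S_I by (simp add: row_prob frobenius_norm_eq_norm)
      show "(sigma_min A)\<^sup>2 * (norm (D k \<omega>))\<^sup>2 \<le> (norm (A ** D k \<omega>))\<^sup>2" if "\<omega> \<in> space M" for \<omega>
        using D_range[OF that, of k] sigma_min_sq_mult_norm_sq_le(1)[OF A] by metis
      show "D k \<omega> = D k \<omega>'" if "\<omega> \<in> space M" "\<omega>' \<in> space M" "S ?K \<omega> = S ?K \<omega>'" for \<omega> \<omega>'
        by (rule D_S[OF that]) blast
      show "Y (Suc k) \<omega> - ?L = Y (Suc k) \<omega>' - ?L"
        if "\<omega> \<in> space M" "\<omega>' \<in> space M" "S ?K \<omega> = S ?K \<omega>'" for \<omega> \<omega>'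
        unfolding Y_S[OF that] ..
    qed
    finally show ?thesis by (simp add: r_def e_def E_def \<rho>)
  qed

  \<comment> \<open>Solving the recursions\<close>
  have \<rho>_bounds: "0 \<le> \<rho>" "\<rho> < 1"
  proof -
    have "(sigma_min A)\<^sup>2 \<le> (norm A)\<^sup>2"
      using sigma_min_le_norm[OF A] sigma_min_pos[OF A] by (intro power_mono) auto
    then show "0 \<le> \<rho>" using nA by (simp add: \<rho>)
    show "\<rho> < 1" using nA sigma_min_pos[OF A] by (simp add: \<rho>)
  qed
  let ?r0 = "(norm (A ** Y0 - A ** pinv A ** B))\<^sup>2" and ?e0 = "(norm (X0 - ?L))\<^sup>2"
  have r0: "r 0 = ?r0"
  proof -
    have "r 0 = expectation (\<lambda>_. ?r0)"
      unfolding r_def by (rule Bochner_Integration.integral_cong[OF refl])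
        (simp add: E_def Y_0 matrix_diff_ldistrib matrix_mul_assoc)
    then show ?thesis by (simp add: prob_space)
  qed
  have e0: "e 0 = ?e0"
  proof -
    have "e 0 = expectation (\<lambda>_. ?e0)"
      unfolding e_def by (rule Bochner_Integration.integral_cong[OF refl]) (simp add: D_def X_0)
    then show ?thesis by (simp add: prob_space)
  qed
  have bound: "e k \<le> real k * \<rho> ^ k / (norm A)\<^sup>2 * ?r0 + \<rho> ^ k * ?e0" for k
    using forced_contraction_bound[where r = r and e = e, OF \<rho>_bounds(1) nA r_Suc e_Suc] by (simp only: r0 e0)
  obtain c q where cq: "0 \<le> c" "0 \<le> q" "q < 1"
      "\<And>k. \<rho> ^ k \<le> q ^ k" "\<And>k. real k * \<rho> ^ k \<le> c * q ^ k"
    using linear_times_geometric_bound[OF \<rho>_bounds] by metis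
  \<comment> \<open>The linear factor in \<open>bound\<close> is absorbed by the slower rate
    \<open>q\<close>; a rate strictly between \<open>\<rho>\<close> and 1 suffices for linear
    convergence when \<open>\<rho>\<close> is positive.\<close>
  have geometric: "e k \<le> (c / (norm A)\<^sup>2 * ?r0 + ?e0) * q ^ k" for k
  proof -
    have "real k * \<rho> ^ k / (norm A)\<^sup>2 * ?r0 + \<rho> ^ k * ?e0
        \<le> c * q ^ k / (norm A)\<^sup>2 * ?r0 + q ^ k * ?e0"
      using nA by (intro add_mono mult_right_mono divide_right_mono cq) auto
    then show ?thesis using bound[of k] by (simp add: algebra_simps)
  qed
  have "converges_linearly_in_mean_square M X ?L"
    unfolding converges_linearly_in_mean_square_def frobenius_norm_eq_norm
  proof (intro conjI allI exI)
    show "integrable M (\<lambda>\<omega>. (norm (X k \<omega> - ?L))\<^sup>2)" for k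
      using int_D[of k] by (simp add: D_def)
    show "expectation (\<lambda>\<omega>. (norm (X k \<omega> - ?L))\<^sup>2) \<le> (c / (norm A)\<^sup>2 * ?r0 + ?e0) * q ^ k" for k
      using geometric[of k] by (simp add: e_def D_def)
  qed (use cq nA in auto)
  moreover have "expectation (\<lambda>\<omega>. (norm (X (Suc k) \<omega> - ?L))\<^sup>2)
      \<le> real (k + 1) * \<rho> ^ (k + 1) / (norm A)\<^sup>2 * ?r0 + \<rho> ^ (k + 1) * ?e0" for k
    using bound[of "Suc k"] by (simp add: e_def D_def)
  ultimately show ?thesis
    unfolding frobenius_norm_eq_norm by blast
qed

end
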